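(* Let $(\mathbb{M}_n,\{\cdot,\cdot\})$ be a Poisson manifold with local coordinates $z^i$, let $H$ be a given function, and let $\Phi^\alpha$ be a set of functionally independent functions such that $\triangle^{\alpha\beta}=\{\Phi^\alpha,\Phi^\beta\}$ satisfies $\det\triangle^{\alpha\beta}\big|_{\Phi^\alpha=0}\ne0$. Let $\tilde\triangle_{\alpha\beta}$ be the inverse matrix of $\triangle^{\alpha\beta}$. Then the equations $$\dot z^i=\{z^i,\tilde H\},\qquad \Phi^\alpha(z)=0,$$ with the Hamiltonian $$\tilde H=H-\Phi^\alpha\,\tilde\triangle_{\alpha\beta}\,\{\Phi^\beta,H\},$$ form a self-consistent system: through any point of the surface $\{\Phi^\alpha=0\}$ passes a solution of the whole system.
   Context: All objects are smooth, and all statements are local (solutions are defined for $\tau$ in a neighbourhood of the initial time; $\tilde H$ is considered in a neighbourhood of $\{\Phi^\alpha=0\}$ where $\triangle^{\alpha\beta}$ is invertible). Repeated indices are summed and $\dot z^i=dz^i/d\tau$. A Poisson bracket is $\{A,B\}=\partial_iA\,\omega^{ij}\,\partial_jB$ with $\omega^{ij}=-\omega^{ji}$ and $\omega^{ip}\partial_p\omega^{jk}+\mathrm{cycle}(i,j,k)=0$. Functions $\Phi^1,\dots,\Phi^p$ are functionally independent if $\operatorname{rank}(\partial_i\Phi^\alpha)=p$. A system consisting of differential equations $\dot z^i=V^i(z)$ and algebraic equations $\Phi^\alpha(z)=0$ is called self-consistent if through any point of the surface $\{\Phi^\alpha=0\}$ passes a solution $z^i(\tau)$ of the system (so $\Phi^\alpha(z(\tau))=0$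 for all $\tau$). *)

theory Defs
  imports "HOL-Analysis.Analysis"
begin

text \<open>
  Everything is local, so the Poisson manifold is represented by a coordinate domain:
  an open set \<open>U\<close> of \<open>real ^ 'n\<close> carrying the tensor \<open>\<omega> z $ i $ j\<close>.
\<close>

(* For open S: all iterated partial derivatives up to order k exist and are continuous.
   Frechet differentiability is automatic once the partial derivatives are continuous. *)
primrec Ck_on ::
  "nat \<Rightarrow> 'a::euclidean_space set \<Rightarrow> ('a \<Rightarrow> 'b::real_normed_vector) \<Rightarrow> bool"
where
  "Ck_on 0 S f \<longleftrightarrow> continuous_on S f"
| "Ck_on (Suc k) S f \<longleftrightarrow>
     (\<forall>x\<in>S. f differentiable (at x)) \<and>
     (\<forall>b\<in>Basis. Ck_on k S (\<lambda>x. frechet_derivative f (at x) b))"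

definition smooth_on ::
  "'a::euclidean_space set \<Rightarrow> ('a \<Rightarrow> 'b::real_normed_vector) \<Rightarrow> bool"
where
  "smooth_on S f \<longleftrightarrow> (\<forall>k. Ck_on k S f)"

definition partial_deriv :: "'n::finite \<Rightarrow> (real ^ 'n \<Rightarrow> real) \<Rightarrow> real ^ 'n \<Rightarrow> real"
where
  "partial_deriv i f z = frechet_derivative f (at z) (axis i 1)"

definition pbracket ::
  "(real ^ 'n \<Rightarrow> real ^ 'n ^ 'n) \<Rightarrow> (real ^ 'n::finite \<Rightarrow> real) \<Rightarrow> (real ^ 'n \<Rightarrow> real)
    \<Rightarrow> real ^ 'n \<Rightarrow> real"
where
  "pbracket \<omega> A B z =
     (\<Sum>i\<in>UNIV. \<Sum>j\<in>UNIV. partial_deriv i A z * \<omega> z $ i $ j * partial_deriv j B z)"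

definition poisson_structure_on ::
  "(real ^ 'n) set \<Rightarrow> (real ^ 'n::finite \<Rightarrow> real ^ 'n ^ 'n) \<Rightarrow> bool"
where
  "poisson_structure_on U \<omega> \<longleftrightarrow>
     smooth_on U \<omega> \<and>
     (\<forall>z\<in>U. \<forall>i j. \<omega> z $ i $ j = - \<omega> z $ j $ i) \<and>
     (\<forall>z\<in>U. \<forall>i j k.
        (\<Sum>p\<in>UNIV. \<omega> z $ i $ p * partial_deriv p (\<lambda>y. \<omega> y $ j $ k) z) +
        (\<Sum>p\<in>UNIV. \<omega> z $ j $ p * partial_deriv p (\<lambda>y. \<omega> y $ k $ i) z) +
        (\<Sum>p\<in>UNIV. \<omega> z $ k $ p * partial_deriv p (\<lambda>y. \<omega> y $ i $ j) z) = 0)"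

definition functionally_independent_on ::
  "(real ^ 'n) set \<Rightarrow> ('p::finite \<Rightarrow> real ^ 'n::finite \<Rightarrow> real) \<Rightarrow> bool"
where
  "functionally_independent_on U \<Phi> \<longleftrightarrow>
     (\<forall>z\<in>U. rank (\<chi> \<alpha> i. partial_deriv i (\<Phi> \<alpha>) z) = CARD('p))"

definition constraint_surface ::
  "(real ^ 'n) set \<Rightarrow> ('p \<Rightarrow> real ^ 'n::finite \<Rightarrow> real) \<Rightarrow> (real ^ 'n) set"
where
  "constraint_surface U \<Phi> = {z \<in> U. \<forall>\<alpha>. \<Phi> \<alpha> z = 0}"

definition constraint_matrix ::
  "(real ^ 'n \<Rightarrow> real ^ 'n ^ 'n) \<Rightarrow> ('p::finite \<Rightarrow> real ^ 'n::finite \<Rightarrow> real)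
    \<Rightarrow> real ^ 'n \<Rightarrow> real ^ 'p ^ 'p"
where
  "constraint_matrix \<omega> \<Phi> z = (\<chi> \<alpha> \<beta>. pbracket \<omega> (\<Phi> \<alpha>) (\<Phi> \<beta>) z)"

(* Meaningful where the constraint matrix is invertible, which is a neighbourhood of the
   constraint surface; elsewhere matrix_inv is unspecified. *)
definition modified_hamiltonian ::
  "(real ^ 'n \<Rightarrow> real ^ 'n ^ 'n) \<Rightarrow> ('p::finite \<Rightarrow> real ^ 'n::finite \<Rightarrow> real)
    \<Rightarrow> (real ^ 'n \<Rightarrow> real) \<Rightarrow> real ^ 'n \<Rightarrow> real"
where
  "modified_hamiltonian \<omega> \<Phi> H z =
     H z - (\<Sum>\<alpha>\<in>UNIV. \<Sum>\<beta>\<in>UNIV.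
       \<Phi> \<alpha> z * matrix_inv (constraint_matrix \<omega> \<Phi> z) $ \<alpha> $ \<beta> * pbracket \<omega> (\<Phi> \<beta>) H z)"

definition hamiltonian_vector_field ::
  "(real ^ 'n \<Rightarrow> real ^ 'n ^ 'n) \<Rightarrow> (real ^ 'n::finite \<Rightarrow> real) \<Rightarrow> real ^ 'n \<Rightarrow> real ^ 'n"
where
  "hamiltonian_vector_field \<omega> H z = (\<chi> i. pbracket \<omega> (\<lambda>y. y $ i) H z)"

definition solution_on ::
  "(real ^ 'n) set \<Rightarrow> (real ^ 'n::finite \<Rightarrow> real ^ 'n) \<Rightarrow> ('p \<Rightarrow> real ^ 'n \<Rightarrow> real)
    \<Rightarrow> real set \<Rightarrow> (real \<Rightarrow> real ^ 'n) \<Rightarrow> bool"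
where
  "solution_on U V \<Phi> T z \<longleftrightarrow>
     smooth_on T z \<and>
     (\<forall>\<tau>\<in>T. z \<tau> \<in> U \<and> (z has_vector_derivative V (z \<tau>)) (at \<tau>) \<and> (\<forall>\<alpha>. \<Phi> \<alpha> (z \<tau>) = 0))"

definition self_consistent ::
  "(real ^ 'n) set \<Rightarrow> (real ^ 'n::finite \<Rightarrow> real ^ 'n) \<Rightarrow> ('p \<Rightarrow> real ^ 'n \<Rightarrow> real) \<Rightarrow> bool"
where
  "self_consistent U V \<Phi> \<longleftrightarrow>
     (\<forall>z\<^sub>0\<in>constraint_surface U \<Phi>. \<exists>T \<tau>\<^sub>0 z.
        open T \<and> is_interval T \<and> \<tau>\<^sub>0 \<in> T \<and> z \<tau>\<^sub>0 = z\<^sub>0 \<and> solution_on U V \<Phi> T z)"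

end

theory Submission
  imports Defs
begin

text \<open>
  Put \<open>g\<^sub>\<beta> = \<Delta>\<^sub>\<beta>\<^sub>\<gamma> {\<Phi>\<^sup>\<gamma>, H}\<close> with \<open>\<Delta>\<^sub>\<beta>\<^sub>\<gamma>\<close> the inverse of the constraint matrix. Where that matrix is
  invertible, the modified Hamiltonian is \<open>H - \<Phi>\<^sup>\<beta> g\<^sub>\<beta>\<close>, and in its bracket with \<open>\<Phi>\<^sup>\<alpha>\<close> the terms
  \<open>{\<Phi>\<^sup>\<alpha>, H}\<close> and \<open>{\<Phi>\<^sup>\<alpha>, \<Phi>\<^sup>\<beta>} g\<^sub>\<beta>\<close> cancel, leaving \<open>- \<Phi>\<^sup>\<beta> {\<Phi>\<^sup>\<alpha>, g\<^sub>\<beta>}\<close>. Hence along the flow the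
  constraints satisfy a homogeneous linear system with bounded coefficients, so that they stay zero
  if they vanish initially. The flow exists by the Picard-Lindeloef theorem.
\<close>

subsection \<open>Smooth functions\<close>

text \<open>The derivative at a point of an open set depends only on nearby values, so agreement on
  \<open>S\<close> is inherited by the derivatives at every level of the recursion.\<close>

lemma Ck_on_cong:
  assumes "open S" "\<And>x. x \<in> S \<Longrightarrow> f x = g x" "Ck_on k S f"
  shows "Ck_on k S g"
  using assms(2,3)
proof (induction k arbitrary: f g)
  case 0
  then show ?case using continuous_on_cong[of S S f g] by simp
next
  case (Suc k)
  have diff: "f differentiable (at x)" if "x \<in> S" for x
    using Suc.prems(2) that by simp
  have eq: "frechet_derivative f (at x) = frechet_derivative g (at x)" if "x \<in> S" for x
    using frechet_derivative_transform_within_open[OF diff[OF that] assms(1) that] Suc.prems(1)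
    by blast
  have "g differentiable (at x)" if "x \<in> S" for x
  proof -
    have "(f has_derivative frechet_derivative f (at x)) (at x)"
      using diff[OF that] by (simp add: frechet_derivative_works[symmetric])
    then show ?thesis
      using has_derivative_transform_within_open[OF _ assms(1) that] Suc.prems(1)
      unfolding differentiable_def by blast
  qed
  moreover have "Ck_on k S (\<lambda>x. frechet_derivative g (at x) b)" if "b \<in> Basis" for b
    using Suc.IH[of "\<lambda>x. frechet_derivative f (at x) b"] Suc.prems(2) eq that by simp
  ultimately show ?case by simp
qed

text \<open>\<open>frechet_derivative\<close> is defined by choice; this rule lets the proofs below
  work with an explicit formula for the derivative.\<close>

lemma Ck_on_SucI:
  assumes "open S"
    and der: "\<And>x. x \<in> S \<Longrightarrow> (f has_derivative f' x) (at x)"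
    and "\<And>b. b \<in> Basis \<Longrightarrow> Ck_on k S (\<lambda>x. f' x b)"
  shows "Ck_on (Suc k) S f"
proof -
  have "frechet_derivative f (at x) = f' x" if "x \<in> S" for x
    using frechet_derivative_at[OF der[OF that]] by simp
  then have "Ck_on k S (\<lambda>x. frechet_derivative f (at x) b)" if "b \<in> Basis" for b
    using Ck_on_cong[OF assms(1) _ assms(3)[OF that]] by simp
  moreover have "f differentiable (at x)" if "x \<in> S" for x
    using der[OF that] unfolding differentiable_def by blast
  ultimately show ?thesis by simp
qed

lemma Ck_on_Suc_has_derivative:
  assumes "Ck_on (Suc k) S f" "x \<in> S"
  shows "(f has_derivative frechet_derivative f (at x)) (at x)"
  using assms by (simp add: frechet_derivative_works[symmetric])

lemma Ck_on_SucD: "Ck_on (Suc k) S f \<Longrightarrow> Ck_on k S f"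
proof (induction k arbitrary: f)
  case 0
  then have "f differentiable_on S"
    by (simp add: differentiable_at_imp_differentiable_on)
  then show ?case by (simp add: differentiable_imp_continuous_on)
next
  case (Suc k)
  have "Ck_on k S (\<lambda>x. frechet_derivative f (at x) b)" if "b \<in> Basis" for b
    using Suc.IH Suc.prems that by simp
  with Suc.prems show ?case by simp
qed

lemma Ck_on_subset: "Ck_on k S f \<Longrightarrow> T \<subseteq> S \<Longrightarrow> Ck_on k T f"
proof (induction k arbitrary: f)
  case 0
  then show ?case by (auto intro: continuous_on_subset)
next
  case (Suc k)
  then show ?case by auto
qed

lemma Ck_on_const: "open S \<Longrightarrow> Ck_on k S (\<lambda>x. c)"
proof (induction k arbitrary: c)
  case (Suc k)
  then show ?case by (intro Ck_on_SucI[where f'="\<lambda>x h. 0"]) auto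
qed auto

lemma Ck_on_bounded_linear_compose:
  assumes L: "bounded_linear L" and "open S"
  shows "Ck_on k S f \<Longrightarrow> Ck_on k S (\<lambda>x. L (f x))"
proof (induction k arbitrary: f)
  case 0
  then show ?case
    by (simp add: bounded_linear.continuous_on[OF L])
next
  case (Suc k)
  show ?case
  proof (rule Ck_on_SucI[OF assms(2)])
    show "((\<lambda>x. L (f x)) has_derivative (\<lambda>h. L (frechet_derivative f (at x) h))) (at x)"
      if "x \<in> S" for x
      using bounded_linear.has_derivative[OF L Ck_on_Suc_has_derivative[OF Suc.prems that]] .
  qed (use Suc in simp)
qed

lemma Ck_on_add:
  assumes "open S"
  shows "Ck_on k S f \<Longrightarrow> Ck_on k S g \<Longrightarrow> Ck_on k S (\<lambda>x. f x + g x)"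
proof (induction k arbitrary: f g)
  case 0
  then show ?case by (auto intro: continuous_on_add)
next
  case (Suc k)
  show ?case
  proof (rule Ck_on_SucI[OF assms])
    show "((\<lambda>x. f x + g x) has_derivative
        (\<lambda>h. frechet_derivative f (at x) h + frechet_derivative g (at x) h)) (at x)"
      if "x \<in> S" for x
      by (intro has_derivative_add Ck_on_Suc_has_derivative[OF Suc.prems(1) that]
          Ck_on_Suc_has_derivative[OF Suc.prems(2) that])
  qed (use Suc in simp)
qed

text \<open>The product rule gives two terms, each with one undifferentiated factor. Hence the
  induction runs over all pairs \<open>f\<close>, \<open>g\<close>, and \<open>Ck_on_SucD\<close>
  lowers the order of that factor.\<close>

lemma Ck_on_bounded_bilinear:
  assumes B: "bounded_bilinear B" and "open S"
  shows "Ck_on k S f \<Longrightarrow> Ck_on k S g \<Longrightarrow> Ck_on k S (\<lambda>x. B (f x) (g x))"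
proof (induction k arbitrary: f g)
  case 0
  then show ?case by (simp add: bounded_bilinear.continuous_on[OF B])
next
  case (Suc k)
  show ?case
  proof (rule Ck_on_SucI[OF assms(2)])
    show "((\<lambda>x. B (f x) (g x)) has_derivative
        (\<lambda>h. B (f x) (frechet_derivative g (at x) h) + B (frechet_derivative f (at x) h) (g x)))
        (at x)" if "x \<in> S" for x
      by (rule bounded_bilinear.FDERIV[OF B Ck_on_Suc_has_derivative[OF Suc.prems(1) that]
            Ck_on_Suc_has_derivative[OF Suc.prems(2) that]])
    show "Ck_on k S (\<lambda>x. B (f x) (frechet_derivative g (at x) b)
        + B (frechet_derivative f (at x) b) (g x))" if "b \<in> Basis" for b
      using Ck_on_SucD[OF Suc.prems(1)] Ck_on_SucD[OF Suc.prems(2)] Suc.prems that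
      by (intro Ck_on_add[OF assms(2)] Suc.IH) auto
  qed
qed

text \<open>The derivative is built from the inverse itself and the derivative of \<open>f\<close>;
  the induction hypothesis covers the former, and the bilinear rule covers the products.\<close>

lemma Ck_on_inverse:
  fixes f :: "'a::euclidean_space \<Rightarrow> real"
  assumes "open S" and nz: "\<And>x. x \<in> S \<Longrightarrow> f x \<noteq> 0"
  shows "Ck_on k S f \<Longrightarrow> Ck_on k S (\<lambda>x. inverse (f x))"
proof (induction k)
  case 0
  then show ?case using nz by (auto intro: continuous_on_inverse)
next
  case (Suc k)
  note mult = Ck_on_bounded_bilinear[OF bounded_bilinear_mult assms(1)]
  show ?case
  proof (rule Ck_on_SucI[OF assms(1)])
    show "((\<lambda>x. inverse (f x)) has_derivative
        (\<lambda>h. - (inverse (f x) * frechet_derivative f (at x) h * inverse (f x)))) (at x)"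
      if "x \<in> S" for x
      by (rule Deriv.has_derivative_inverse[OF nz[OF that] Ck_on_Suc_has_derivative[OF Suc.prems that]])
    have "Ck_on k S (\<lambda>x. inverse (f x))"
      using Suc.IH Ck_on_SucD[OF Suc.prems] by blast
    then show "Ck_on k S (\<lambda>x. - (inverse (f x) * frechet_derivative f (at x) b * inverse (f x)))"
      if "b \<in> Basis" for b
      using Suc.prems that
      by (intro Ck_on_bounded_linear_compose[OF bounded_linear_minus[OF bounded_linear_ident] assms(1)] mult) auto
  qed
qed

section \<open>Closure properties of smooth functions\<close>

lemma smooth_on_cong:
  "open S \<Longrightarrow> (\<And>x. x \<in> S \<Longrightarrow> f x = g x) \<Longrightarrow> smooth_on S f \<Longrightarrow> smooth_on S g"
  unfolding smooth_on_def using Ck_on_cong by blast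

lemma smooth_on_subset: "smooth_on S f \<Longrightarrow> T \<subseteq> S \<Longrightarrow> smooth_on T f"
  unfolding smooth_on_def using Ck_on_subset by blast

lemma smooth_on_const: "open S \<Longrightarrow> smooth_on S (\<lambda>x. c)"
  unfolding smooth_on_def using Ck_on_const by blast

lemma smooth_on_bounded_linear_compose:
  "bounded_linear L \<Longrightarrow> open S \<Longrightarrow> smooth_on S f \<Longrightarrow> smooth_on S (\<lambda>x. L (f x))"
  unfolding smooth_on_def using Ck_on_bounded_linear_compose by blast

lemma smooth_on_bounded_linear:
  assumes L: "bounded_linear L" and "open S"
  shows "smooth_on S L"
  unfolding smooth_on_def
proof
  fix k
  show "Ck_on k S L"
  proof (cases k)
    case 0
    then show ?thesis using L by (simp add: linear_continuous_on)
  next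
    case (Suc m)
    have "Ck_on (Suc m) S L"
      by (rule Ck_on_SucI[OF assms(2)
            bounded_linear_imp_has_derivative[OF L] Ck_on_const[OF assms(2)]])
    then show ?thesis using Suc by simp
  qed
qed

lemma smooth_on_add:
  "open S \<Longrightarrow> smooth_on S f \<Longrightarrow> smooth_on S g \<Longrightarrow> smooth_on S (\<lambda>x. f x + g x)"
  unfolding smooth_on_def using Ck_on_add by blast

lemma smooth_on_minus: "open S \<Longrightarrow> smooth_on S f \<Longrightarrow> smooth_on S (\<lambda>x. - f x)"
  using smooth_on_bounded_linear_compose[OF bounded_linear_minus[OF bounded_linear_ident]] .

lemma smooth_on_diff:
  "open S \<Longrightarrow> smooth_on S f \<Longrightarrow> smooth_on S g \<Longrightarrow> smooth_on S (\<lambda>x. f x - g x)"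
  using smooth_on_add[OF _ _ smooth_on_minus, of S f g] by simp

lemma smooth_on_bounded_bilinear:
  "bounded_bilinear B \<Longrightarrow> open S \<Longrightarrow> smooth_on S f \<Longrightarrow> smooth_on S g \<Longrightarrow>
    smooth_on S (\<lambda>x. B (f x) (g x))"
  unfolding smooth_on_def using Ck_on_bounded_bilinear by blast

lemmas smooth_on_scaleR = smooth_on_bounded_bilinear[OF bounded_bilinear_scaleR]

lemma smooth_on_mult:
  fixes f g :: "'a::euclidean_space \<Rightarrow> real"
  shows "open S \<Longrightarrow> smooth_on S f \<Longrightarrow> smooth_on S g \<Longrightarrow> smooth_on S (\<lambda>x. f x * g x)"
  by (rule smooth_on_bounded_bilinear[OF bounded_bilinear_mult])

lemma smooth_on_divide:
  fixes f g :: "'a::euclidean_space \<Rightarrow> real"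
  assumes "open S" "smooth_on S f" "smooth_on S g" "\<And>x. x \<in> S \<Longrightarrow> g x \<noteq> 0"
  shows "smooth_on S (\<lambda>x. f x / g x)"
proof -
  have "smooth_on S (\<lambda>x. inverse (g x))"
    using assms Ck_on_inverse[of S g] by (simp add: smooth_on_def)
  then show ?thesis
    unfolding divide_inverse by (intro smooth_on_mult assms)
qed

lemma smooth_on_sum:
  assumes "open S" "\<And>i. i \<in> I \<Longrightarrow> smooth_on S (f i)"
  shows "smooth_on S (\<lambda>x. \<Sum>i\<in>I. f i x)"
  using assms(2)
  by (induction I rule: infinite_finite_induct)
    (auto simp: smooth_on_const[OF assms(1)] intro: smooth_on_add[OF assms(1)])

lemma smooth_on_prod:
  fixes f :: "'i \<Rightarrow> 'a::euclidean_space \<Rightarrow> real"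
  assumes "open S" "\<And>i. i \<in> I \<Longrightarrow> smooth_on S (f i)"
  shows "smooth_on S (\<lambda>x. \<Prod>i\<in>I. f i x)"
  using assms(2)
  by (induction I rule: infinite_finite_induct)
    (auto simp: smooth_on_const[OF assms(1)] intro: smooth_on_mult[OF assms(1)])

lemma smooth_on_vec_nth:
  fixes f :: "'a::euclidean_space \<Rightarrow> 'b::real_normed_vector ^ 'n"
  shows "open S \<Longrightarrow> smooth_on S f \<Longrightarrow> smooth_on S (\<lambda>x. f x $ i)"
  by (rule smooth_on_bounded_linear_compose[OF bounded_linear_vec_nth])

lemma smooth_on_component_iff:
  fixes f :: "'a::euclidean_space \<Rightarrow> real ^ 'n::finite"
  assumes "open S"
  shows "smooth_on S f \<longleftrightarrow> (\<forall>i. smooth_on S (\<lambda>x. f x $ i))"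
proof
  assume "\<forall>i. smooth_on S (\<lambda>x. f x $ i)"
  then have "smooth_on S (\<lambda>x. \<Sum>i\<in>UNIV. f x $ i *\<^sub>R (axis i 1 :: real ^ 'n))"
    by (intro smooth_on_sum smooth_on_scaleR smooth_on_const assms) auto
  moreover have "(\<lambda>x. \<Sum>i\<in>UNIV. f x $ i *\<^sub>R (axis i 1 :: real ^ 'n)) = f"
    using basis_expansion[where 'a=real and 'n='n] by (simp add: scalar_mult_eq_scaleR)
  ultimately show "smooth_on S f" by simp
qed (use smooth_on_vec_nth[OF assms] in blast)

lemma smooth_on_det:
  fixes A :: "'a::euclidean_space \<Rightarrow> real ^ 'n ^ 'n"
  assumes "open S" "\<And>i j. smooth_on S (\<lambda>x. A x $ i $ j)"
  shows "smooth_on S (\<lambda>x. det (A x))"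
  unfolding det_def
  by (intro smooth_on_sum smooth_on_mult smooth_on_const smooth_on_prod assms)

section \<open>Cramer's rule and smoothness of the matrix inverse\<close>

lemma matrix_inv_right:
  fixes A :: "real ^ 'n ^ 'n"
  assumes "det A \<noteq> 0"
  shows "A ** matrix_inv A = mat 1"
proof -
  have "\<exists>B. A ** B = mat 1 \<and> B ** A = mat 1"
    using assms by (simp add: invertible_det_nz[symmetric] invertible_def)
  then show ?thesis
    unfolding matrix_inv_def by (rule someI_ex[THEN conjunct1])
qed

text \<open>Column \<open>j\<close> of the inverse solves \<open>A *v x = axis j 1\<close>, so
  Cramer's rule applies. The quotient of determinants gives access to smoothness, which the
  definition of \<open>matrix_inv\<close> by choice does not.\<close>

lemma matrix_inv_component:
  fixes A :: "real ^ 'n ^ 'n"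
  assumes "det A \<noteq> 0"
  shows "matrix_inv A $ i $ j =
    det (\<chi> k l. if l = i then axis j 1 $ k else A $ k $ l) / det A"
proof -
  have "A *v (matrix_inv A *v axis j 1) = axis j 1"
    by (simp add: matrix_vector_mul_assoc matrix_inv_right[OF assms])
  then have "matrix_inv A *v axis j 1 =
      (\<chi> m. det (\<chi> k l. if l = m then axis j 1 $ k else A $ k $ l) / det A)"
    using cramer[OF assms] by blast
  moreover have "(matrix_inv A *v axis j 1) $ i = matrix_inv A $ i $ j"
    by (simp add: matrix_vector_mult_basis column_def)
  ultimately show ?thesis by simp
qed

lemma smooth_on_matrix_inv:
  fixes A :: "'a::euclidean_space \<Rightarrow> real ^ 'n ^ 'n"
  assumes "open S" "\<And>i j. smooth_on S (\<lambda>x. A x $ i $ j)"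
    and nz: "\<And>x. x \<in> S \<Longrightarrow> det (A x) \<noteq> 0"
  shows "smooth_on S (\<lambda>x. matrix_inv (A x) $ i $ j)"
proof -
  \<comment> \<open>Column \<open>i\<close> of Cramer's matrix is constant in \<open>x\<close>; the
    other columns are those of \<open>A x\<close>.\<close>
  have "smooth_on S (\<lambda>x. (\<chi> k l. if l = i then axis j 1 $ k else A x $ k $ l) $ k $ l)" for k l
    by (cases "l = i") (simp_all add: assms smooth_on_const)
  then have "smooth_on S
      (\<lambda>x. det (\<chi> k l. if l = i then axis j 1 $ k else A x $ k $ l) / det (A x))"
    by (intro smooth_on_divide smooth_on_det assms) 
  then show ?thesis
    by (rule smooth_on_cong[OF assms(1), rotated]) (simp add: matrix_inv_component nz)
qed

section \<open>First derivatives of smooth functions and regularity of integral curves\<close>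

lemma smooth_on_imp_continuous_on: "smooth_on S f \<Longrightarrow> continuous_on S f"
  unfolding smooth_on_def by (metis Ck_on.simps(1))

lemma smooth_on_has_derivative:
  "smooth_on S f \<Longrightarrow> x \<in> S \<Longrightarrow> (f has_derivative frechet_derivative f (at x)) (at x)"
  unfolding smooth_on_def using Ck_on_Suc_has_derivative by blast

lemma smooth_on_frechet_derivative_Basis:
  "smooth_on S f \<Longrightarrow> b \<in> Basis \<Longrightarrow> smooth_on S (\<lambda>x. frechet_derivative f (at x) b)"
  unfolding smooth_on_def by (metis Ck_on.simps(2))

lemma frechet_derivative_Basis_sum:
  assumes "smooth_on S f" "x \<in> S"
  shows "frechet_derivative f (at x) v = (\<Sum>b\<in>Basis. (v \<bullet> b) *\<^sub>R frechet_derivative f (at x) b)"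
proof -
  interpret bounded_linear "frechet_derivative f (at x)"
    using smooth_on_has_derivative[OF assms] by (rule has_derivative_bounded_linear)
  have "frechet_derivative f (at x) v = frechet_derivative f (at x) (\<Sum>b\<in>Basis. (v \<bullet> b) *\<^sub>R b)"
    by (simp add: euclidean_representation)
  then show ?thesis by (simp add: sum scaleR)
qed

text \<open>Expanding \<open>V x\<close> in the basis turns a derivative in a variable direction
  into a finite sum of basis derivatives with smooth coefficients.\<close>

lemma smooth_on_frechet_derivative:
  assumes "open S" "smooth_on S f" "smooth_on S V"
  shows "smooth_on S (\<lambda>x. frechet_derivative f (at x) (V x))"
proof -
  have "smooth_on S (\<lambda>x. \<Sum>b\<in>Basis. (V x \<bullet> b) *\<^sub>R frechet_derivative f (at x) b)"
    by (intro smooth_on_sum smooth_on_scaleR smooth_on_frechet_derivative_Basis assms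
        smooth_on_bounded_linear_compose[OF bounded_linear_inner_left])
  then show ?thesis
    by (rule smooth_on_cong[OF assms(1), rotated]) (simp add: frechet_derivative_Basis_sum[OF assms(2)])
qed

text \<open>Along an integral curve the derivative of \<open>g \<circ> z\<close> is \<open>(Dg \<cdot> V) \<circ> z\<close>, again a smooth
  function composed with \<open>z\<close>; this bootstraps the regularity of \<open>z\<close> without a chain rule for
  higher derivatives.\<close>

lemma smooth_on_integral_curve:
  fixes z :: "real \<Rightarrow> 'a::euclidean_space"
  assumes "open W" "smooth_on W V" "open T"
    and zW: "\<And>t. t \<in> T \<Longrightarrow> z t \<in> W"
    and dz: "\<And>t. t \<in> T \<Longrightarrow> (z has_vector_derivative V (z t)) (at t)"
  shows "smooth_on T z"
proof -
  have der: "((\<lambda>t. g (z t)) has_derivative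
      (\<lambda>h. h *\<^sub>R frechet_derivative g (at (z t)) (V (z t)))) (at t)"
    if "smooth_on W g" "t \<in> T" for g :: "'a \<Rightarrow> 'a" and t
  proof -
    have D: "(g has_derivative frechet_derivative g (at (z t))) (at (z t))"
      using smooth_on_has_derivative[OF that(1) zW[OF that(2)]] .
    have "((\<lambda>t. g (z t)) has_derivative
        (\<lambda>h. frechet_derivative g (at (z t)) (h *\<^sub>R V (z t)))) (at t)"
      using has_derivative_compose[OF dz[OF that(2), unfolded has_vector_derivative_def] D] .
    then show ?thesis
      by (simp add: linear_cmul[OF has_derivative_linear[OF D]])
  qed
  have "Ck_on k T (\<lambda>t. g (z t))" if "smooth_on W g" for k and g :: "'a \<Rightarrow> 'a"
    using that
  proof (induction k arbitrary: g)
    case 0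
    then show ?case
      using has_derivative_continuous[OF der]
      by (auto simp: continuous_at_imp_continuous_on)
  next
    case (Suc k)
    show ?case
      using Suc.IH[OF smooth_on_frechet_derivative[OF assms(1) Suc.prems assms(2)]]
      by (intro Ck_on_SucI[OF assms(3) der[OF Suc.prems]]) auto
  qed
  \<comment> \<open>For \<open>g\<close> the identity, \<open>g (z t)\<close> is the curve
    itself.\<close>
  from this[OF smooth_on_bounded_linear[OF bounded_linear_ident assms(1)]]
  show ?thesis unfolding smooth_on_def by simp
qed

subsection \<open>Ordinary differential equations\<close>

text \<open>Picard iteration: the integral operator contracts the sup distance by the factor
  \<open>L * h\<close>, which is at most 1/2, so Banach's fixed point theorem supplies the
  solution.\<close>

lemma picard_lindelof_global_lipschitz:
  fixes F :: "'a::euclidean_space \<Rightarrow> 'a"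
  assumes L: "\<And>x y. norm (F x - F y) \<le> L * norm (x - y)" and h: "0 < h" "L * h \<le> 1/2"
  obtains z where "z 0 = z\<^sub>0" "\<And>t. t \<in> {-h..h} \<Longrightarrow> (z has_vector_derivative F (z t)) (at t within {-h..h})"
proof -
  have contF: "continuous_on X F" for X
  proof (rule continuous_onI)
    fix x e assume "(0::real) < e"
    \<comment> \<open>The sign of \<open>L\<close> is not yet known, and \<open>L\<close> may be
      zero; \<open>\<bar>L\<bar> + 1\<close> is positive in any case.\<close>
    have "dist (F y) (F x) \<le> e" if "dist y x < e / (\<bar>L\<bar> + 1)" for y
    proof -
      have "dist (F y) (F x) \<le> (\<bar>L\<bar> + 1) * dist y x"
        using L[of y x] by (simp add: dist_norm) (smt (verit) mult_right_mono norm_ge_zero)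
      also have "\<dots> \<le> e"
        using that by (simp add: field_simps)
      finally show ?thesis .
    qed
    then show "\<exists>d>0. \<forall>y\<in>X. dist y x < d \<longrightarrow> dist (F y) (F x) \<le> e"
      using \<open>0 < e\<close> by (intro exI[of _ "e / (\<bar>L\<bar> + 1)"]) auto
  qed
  \<comment> \<open>The Lipschitz bound for a unit basis vector and the origin has right-hand side
    \<open>L\<close>.\<close>
  have "0 \<le> L"
    using L[of "SOME b. b \<in> Basis" 0] norm_ge_zero order_trans
    by (metis SOME_Basis mult_1_right norm_Basis diff_zero)
  \<comment> \<open>The oriented integral from 0 to \<open>t\<close>, written as a difference so
    that negative \<open>t\<close> needs no separate case.\<close>
  define I where "I x t = integral {-h..t} (\<lambda>s. F (x s)) - integral {-h..0} (\<lambda>s. F (x s))" for x t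
  have dI: "(I x has_vector_derivative F (x t)) (at t within {-h..h})"
    if "continuous_on {-h..h} x" "t \<in> {-h..h}" for x t
    unfolding I_def
    using has_vector_derivative_diff_const integral_has_vector_derivative[OF
        continuous_on_compose2[OF contF[of UNIV] that(1)] that(2)] by fastforce
  have contx: "continuous_on {-h..h} (apply_bcontfun x)" for x :: "real \<Rightarrow>\<^sub>C 'a"
    by simp
  \<comment> \<open>Clamping the time extends the Picard image by constants outside
    \<open>{-h..h}\<close>. It thus becomes a bounded continuous function on the whole line, an
    element of a complete metric space.\<close>
  have "\<exists>y :: real \<Rightarrow>\<^sub>C 'a. \<forall>t. y t = z\<^sub>0 + I x (clamp (-h) h t)" for x :: "real \<Rightarrow>\<^sub>C 'a"
  proof -
    have "continuous_on {-h..h} (\<lambda>t. z\<^sub>0 + I x t)"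
      using continuous_on_vector_derivative[OF dI[OF contx[of x]]]
      by (intro continuous_intros) auto
    then show ?thesis
      using continuous_on_cbox_bcontfunE[of "-h" h] by (metis cbox_interval)
  qed
  then obtain P :: "(real \<Rightarrow>\<^sub>C 'a) \<Rightarrow> (real \<Rightarrow>\<^sub>C 'a)"
    where P: "\<And>x t. P x t = z\<^sub>0 + I x (clamp (-h) h t)"
    by metis
  have "dist (P x) (P y) \<le> 1/2 * dist x y" for x y
  proof (rule dist_bound)
    fix t
    define s where "s = clamp (-h) h t"
    have s: "s \<in> {-h..h}"
      using h clamp_in_interval[of "-h" h t] by (simp add: s_def)
    \<comment> \<open>The contraction estimate comes from the mean value inequality for
      \<open>I x - I y\<close>; both integrals vanish at 0.\<close>
    have "norm ((I x s - I y s) - (I x 0 - I y 0)) \<le> (L * dist x y) * norm (s - 0)"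
    proof (rule differentiable_bound[where S="{-h..h}"])
      show "((\<lambda>u. I x u - I y u) has_derivative (\<lambda>v. v *\<^sub>R (F (x u) - F (y u)))) (at u within {-h..h})"
        if "u \<in> {-h..h}" for u
        using has_vector_derivative_diff[OF dI[OF contx that] dI[OF contx that]]
        by (simp add: has_vector_derivative_def)
      have "norm (F (x u) - F (y u)) \<le> L * dist x y" for u
        using L[of "x u" "y u"] mult_left_mono[OF dist_bounded[of x u y] \<open>0 \<le> L\<close>]
        by (simp add: dist_norm)
      then show "onorm (\<lambda>v. v *\<^sub>R (F (x u) - F (y u))) \<le> L * dist x y" for u
        by (intro onorm_le) (simp add: mult.commute mult_left_mono)
    qed (use s h in auto)
    also have "\<dots> \<le> (L * dist x y) * h"
      using s \<open>0 \<le> L\<close> by (intro mult_left_mono) auto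
    also have "\<dots> \<le> 1/2 * dist x y"
      using mult_right_mono[OF h(2) zero_le_dist[of x y]] by (simp add: mult_ac)
    finally show "dist (P x t) (P y t) \<le> 1/2 * dist x y"
      by (simp add: P s_def dist_norm I_def)
  qed
  then obtain x where x: "P x = x"
    using banach_fix_type[of "1/2" P] by auto
  \<comment> \<open>Without the clamp the formula can be differentiated directly, and on
    \<open>{-h..h}\<close> it agrees with the fixed point.\<close>
  define z where "z t = z\<^sub>0 + I x t" for t
  have zx: "x t = z t" if "t \<in> {-h..h}" for t
    using P[of x t] x that clamp_cancel_cbox[of t "-h" h] by (simp add: z_def)
  show thesis
  proof (rule that)
    show "z 0 = z\<^sub>0" by (simp add: z_def I_def)
    show "(z has_vector_derivative F (z t)) (at t within {-h..h})" if "t \<in> {-h..h}" for t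
      using has_vector_derivative_add[OF has_vector_derivative_const dI[OF contx that], of z\<^sub>0 x] zx[OF that]
      by (simp add: z_def[abs_def])
  qed
qed

text \<open>The field is made globally Lipschitz by precomposing it with the nearest-point projection
  to a ball; for short times the solution does not leave that ball.\<close>

lemma picard_lindelof:
  fixes V :: "'a::euclidean_space \<Rightarrow> 'a"
  assumes r: "0 < r" and L: "\<And>x y. x \<in> cball z\<^sub>0 r \<Longrightarrow> y \<in> cball z\<^sub>0 r \<Longrightarrow> norm (V x - V y) \<le> L * norm (x - y)"
  obtains h z where "0 < h" "z 0 = z\<^sub>0"
    "\<And>t. t \<in> {-h<..<h} \<Longrightarrow> z t \<in> cball z\<^sub>0 r"
    "\<And>t. t \<in> {-h<..<h} \<Longrightarrow> (z has_vector_derivative V (z t)) (at t)"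
proof -
  \<comment> \<open>A positive Lipschitz constant, so that the choice of \<open>h\<close> can divide
    by it.\<close>
  define K where "K = \<bar>L\<bar> + 1"
  have K: "norm (V x - V y) \<le> K * norm (x - y)" if "x \<in> cball z\<^sub>0 r" "y \<in> cball z\<^sub>0 r" for x y
    using order_trans[OF L[OF that] mult_right_mono[of L K]] by (simp add: K_def)
  have "0 < K" by (simp add: K_def)
  define p where "p = closest_point (cball z\<^sub>0 r)"
  have p: "p x \<in> cball z\<^sub>0 r" for x
    using r unfolding p_def by (intro closest_point_in_set) auto
  have lip: "norm (V (p x) - V (p y)) \<le> K * norm (x - y)" for x y
  proof -
    have "norm (p x - p y) \<le> norm (x - y)"
      using closest_point_lipschitz[of "cball z\<^sub>0 r" x y] r by (simp add: p_def dist_norm)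
    then show ?thesis
      using K[OF p p] mult_left_mono[of _ _ K] \<open>0 < K\<close> by (meson less_imp_le order_trans)
  qed
  \<comment> \<open>A bound on the speed: its value at the centre plus the largest variation that
    the Lipschitz bound permits on the ball.\<close>
  define M where "M = norm (V z\<^sub>0) + K * r"
  have M: "norm (V (p x)) \<le> M" for x
  proof -
    have "norm (V (p x) - V z\<^sub>0) \<le> K * norm (p x - z\<^sub>0)"
      using K[OF p, of z\<^sub>0 x] r by simp
    also have "\<dots> \<le> K * r"
      using p[of x] \<open>0 < K\<close> by (intro mult_left_mono) (auto simp: dist_norm norm_minus_commute)
    finally show ?thesis
      using norm_triangle_ineq2[of "V (p x)" "V z\<^sub>0"] by (simp add: M_def)
  qed
  have "0 < M" using r \<open>0 < K\<close> by (simp add: M_def add_nonneg_pos)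
  \<comment> \<open>The first entry makes the Picard operator a contraction; the second keeps the
    distance travelled, at most \<open>M * h\<close>, within \<open>r\<close>.\<close>
  define h where "h = min (1 / (2 * K)) (r / M)"
  have h: "0 < h" "K * h \<le> 1/2" "M * h \<le> r"
    using \<open>0 < K\<close> \<open>0 < M\<close> r by (auto simp: h_def min_def field_simps)
  obtain z where z: "z 0 = z\<^sub>0"
    and dz: "\<And>t. t \<in> {-h..h} \<Longrightarrow> (z has_vector_derivative V (p (z t))) (at t within {-h..h})"
    using picard_lindelof_global_lipschitz[of "\<lambda>x. V (p x)", OF lip h(1,2)] by metis
  have stay: "z t \<in> cball z\<^sub>0 r" if "t \<in> {-h..h}" for t
  proof -
    have "norm (z t - z 0) \<le> M * norm (t - 0)"
    proof (rule differentiable_bound[where S="{-h..h}"])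
      show "(z has_derivative (\<lambda>v. v *\<^sub>R V (p (z u)))) (at u within {-h..h})" if "u \<in> {-h..h}" for u
        using dz[OF that] by (simp add: has_vector_derivative_def)
      show "onorm (\<lambda>v. v *\<^sub>R V (p (z u))) \<le> M" for u
        using mult_left_mono[OF M abs_ge_zero] by (intro onorm_le) (simp add: mult.commute)
    qed (use that h in auto)
    also have "\<dots> \<le> M * h"
      using that \<open>0 < M\<close> by (intro mult_left_mono) auto
    finally show ?thesis
      using h(3) z by (simp add: dist_norm norm_minus_commute)
  qed
  show thesis
  proof (rule that[of h z, OF h(1) z])
    fix t assume t: "t \<in> {-h<..<h}"
    then show zt: "z t \<in> cball z\<^sub>0 r" using stay by simp
    have "p (z t) = z t"
      using closest_point_self[OF zt] by (simp add: p_def)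
    \<comment> \<open>The derivative was obtained relative to the closed interval; at interior
      points it is two-sided.\<close>
    moreover have "at t within {-h..h} = at t"
      using t by (intro at_within_interior) (simp add: interior_atLeastAtMost_real)
    ultimately show "(z has_vector_derivative V (z t)) (at t)"
      using dz[of t] t by simp
  qed
qed

text \<open>Gronwall's argument in both time directions: \<open>u s * exp (- K * s)\<close> does not
  increase to the right of \<open>a\<close>, and \<open>u s * exp (K * s)\<close> does not decrease
  to the left of it. Either way \<open>u t\<close> is at most zero.\<close>

lemma linear_differential_inequality_zero:
  fixes u :: "real \<Rightarrow> real"
  assumes T: "is_interval T" "a \<in> T" "t \<in> T"
    and du: "\<And>t. t \<in> T \<Longrightarrow> (u has_real_derivative u' t) (at t)"
    and bound: "\<And>t. t \<in> T \<Longrightarrow> \<bar>u' t\<bar> \<le> K * u t"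
    and "\<And>t. t \<in> T \<Longrightarrow> 0 \<le> u t" "u a = 0"
  shows "u t = 0"
proof -
  have mem: "s \<in> T" if "min a t \<le> s" "s \<le> max a t" for s
    using mem_is_interval_1_I[OF T(1), of "min a t" "max a t" s] T(2,3) that
    by (simp add: min_def max_def split: if_splits)
  have der: "((\<lambda>s. u s * exp (c * s)) has_real_derivative (u' s + c * u s) * exp (c * s)) (at s)"
    if "s \<in> T" for c s
    by (rule derivative_eq_intros refl du[OF that])+ (simp add: algebra_simps)
  have "u t * exp (c * t) \<le> 0" if "c = (if a \<le> t then - K else K)" for c
  proof (cases "a \<le> t")
    case True
    have "u t * exp (c * t) \<le> u a * exp (c * a)"
    proof (rule DERIV_nonpos_imp_nonincreasing[OF True])
      fix s assume s: "a \<le> s" "s \<le> t"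
      then have "s \<in> T" using mem by auto
      then have "u' s + c * u s \<le> 0" using bound[of s] that True by simp
      then show "\<exists>y. ((\<lambda>s. u s * exp (c * s)) has_real_derivative y) (at s) \<and> y \<le> 0"
        using der[OF \<open>s \<in> T\<close>, of c] by (auto simp: mult_nonpos_nonneg)
    qed
    then show ?thesis using assms(7) by simp
  next
    case False
    have "u t * exp (c * t) \<le> u a * exp (c * a)"
    proof (rule DERIV_nonneg_imp_nondecreasing[where f="\<lambda>s. u s * exp (c * s)"])
      fix s assume s: "t \<le> s" "s \<le> a"
      then have "s \<in> T" using mem by auto
      then have "u' s + c * u s \<ge> 0" using bound[of s] that False by simp
      then show "\<exists>y. ((\<lambda>s. u s * exp (c * s)) has_real_derivative y) (at s) \<and> 0 \<le> y"
        using der[OF \<open>s \<in> T\<close>, of c] by auto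
    qed (use False in simp)
    then show ?thesis using assms(7) by simp
  qed
  then have "u t \<le> 0"
    by (metis exp_gt_zero mult_le_0_iff not_le)
  then show ?thesis using assms(6)[OF T(3)] by simp
qed

text \<open>Continuous derivatives are bounded on a compact ball, and on a convex set a bound on the
  derivative is a Lipschitz constant.\<close>

lemma smooth_on_locally_lipschitz:
  fixes V :: "'a::euclidean_space \<Rightarrow> 'b::real_normed_vector"
  assumes "open W" "smooth_on W V" "z\<^sub>0 \<in> W"
  obtains r L where "0 < r" "cball z\<^sub>0 r \<subseteq> W"
    "\<And>x y. x \<in> cball z\<^sub>0 r \<Longrightarrow> y \<in> cball z\<^sub>0 r \<Longrightarrow> norm (V x - V y) \<le> L * norm (x - y)"
proof -
  obtain r where r: "0 < r" "cball z\<^sub>0 r \<subseteq> W"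
    using assms(1,3) open_contains_cball by blast
  \<comment> \<open>A majorant of the operator norm of the derivative. It is continuous because it
    involves only the basis directions, which smoothness controls.\<close>
  define m where "m x = (\<Sum>b\<in>Basis. norm (frechet_derivative V (at x) b))" for x
  have "continuous_on W m"
    unfolding m_def
    by (intro continuous_intros smooth_on_imp_continuous_on smooth_on_frechet_derivative_Basis assms(2))
  then have "bounded (m ` cball z\<^sub>0 r)"
    using r(2) by (intro compact_imp_bounded compact_continuous_image) (auto intro: continuous_on_subset)
  then obtain L where L: "\<And>x. x \<in> cball z\<^sub>0 r \<Longrightarrow> m x \<le> L"
    unfolding bounded_iff by (metis imageI real_norm_def abs_ge_self order_trans)
  show thesis
  proof (rule that[OF r])
    show "norm (V x - V y) \<le> L * norm (x - y)" if "x \<in> cball z\<^sub>0 r" "y \<in> cball z\<^sub>0 r" for x y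
    proof (rule differentiable_bound[OF convex_cball[of z\<^sub>0 r] _ _ that])
      fix x assume x: "x \<in> cball z\<^sub>0 r"
      then have "x \<in> W" using r by auto
      note D = smooth_on_has_derivative[OF assms(2) this]
      show "(V has_derivative frechet_derivative V (at x)) (at x within cball z\<^sub>0 r)"
        using D by (rule has_derivative_at_withinI)
      show "onorm (frechet_derivative V (at x)) \<le> L"
      proof (rule onorm_le)
        fix v
        have "norm (frechet_derivative V (at x) v)
            \<le> (\<Sum>b\<in>Basis. norm v * norm (frechet_derivative V (at x) b))"
          unfolding frechet_derivative_Basis_sum[OF assms(2) \<open>x \<in> W\<close>, of v]
          by (rule order_trans[OF norm_sum]) (auto intro!: sum_mono mult_right_mono Basis_le_norm)
        also have "\<dots> = m x * norm v"
          by (simp add: m_def sum_distrib_left mult.commute)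
        finally show "norm (frechet_derivative V (at x) v) \<le> L * norm v"
          using mult_right_mono[OF L[OF x], of "norm v"] by simp
      qed
    qed
  qed
qed

subsection \<open>Poisson brackets and Hamiltonian vector fields\<close>

lemma smooth_on_partial_deriv: "smooth_on S f \<Longrightarrow> smooth_on S (partial_deriv i f)"
  using smooth_on_frechet_derivative_Basis[of S f "axis i 1"]
  by (simp add: partial_deriv_def[abs_def])

lemma smooth_on_pbracket:
  assumes "open S" "smooth_on S \<omega>" "smooth_on S A" "smooth_on S B"
  shows "smooth_on S (pbracket \<omega> A B)"
  unfolding pbracket_def[abs_def]
  by (intro smooth_on_sum smooth_on_mult smooth_on_partial_deriv smooth_on_vec_nth assms)

lemma partial_deriv_component: "partial_deriv j (\<lambda>y. y $ i) z = (if i = j then 1 else 0)"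
proof -
  have "frechet_derivative (\<lambda>y. y $ i) (at z) = (\<lambda>h. h $ i)"
    by (rule frechet_derivative_at[symmetric])
      (rule bounded_linear_imp_has_derivative[OF bounded_linear_vec_nth])
  then show ?thesis by (simp add: partial_deriv_def axis_def)
qed

text \<open>The partial derivatives of a coordinate function are Kronecker deltas, so one of the two
  sums collapses.\<close>

lemma hamiltonian_vector_field_component:
  "hamiltonian_vector_field \<omega> H z $ i = (\<Sum>j\<in>UNIV. \<omega> z $ i $ j * partial_deriv j H z)"
proof -
  have "(\<Sum>j\<in>UNIV. partial_deriv k (\<lambda>y. y $ i) z * \<omega> z $ k $ j * partial_deriv j H z) =
      (if i = k then \<Sum>j\<in>UNIV. \<omega> z $ k $ j * partial_deriv j H z else 0)" for k
    by (simp add: partial_deriv_component)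
  then show ?thesis by (simp add: hamiltonian_vector_field_def pbracket_def)
qed

lemma smooth_on_hamiltonian_vector_field:
  assumes "open S" "smooth_on S \<omega>" "smooth_on S H"
  shows "smooth_on S (hamiltonian_vector_field \<omega> H)"
  unfolding smooth_on_component_iff[OF assms(1)] hamiltonian_vector_field_component
  by (intro allI smooth_on_sum smooth_on_mult smooth_on_partial_deriv smooth_on_vec_nth assms)

lemma frechet_derivative_partial_deriv_sum:
  fixes f :: "real ^ 'n::finite \<Rightarrow> real"
  assumes "f differentiable (at z)"
  shows "frechet_derivative f (at z) v = (\<Sum>i\<in>UNIV. v $ i * partial_deriv i f z)"
proof -
  interpret bounded_linear "frechet_derivative f (at z)"
    using assms by (simp add: frechet_derivative_works has_derivative_bounded_linear)
  have "v = (\<Sum>i\<in>UNIV. v $ i *\<^sub>R axis i 1)"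
    using basis_expansion[of v] by (simp add: scalar_mult_eq_scaleR)
  then have "frechet_derivative f (at z) v
      = frechet_derivative f (at z) (\<Sum>i\<in>UNIV. v $ i *\<^sub>R axis i 1)" by simp
  then show ?thesis by (simp add: sum scaleR partial_deriv_def)
qed

text \<open>Combined with the chain rule, this says that the bracket with \<open>H\<close> is the
  rate of change along the flow of \<open>H\<close>.\<close>

lemma frechet_derivative_hamiltonian_vector_field:
  assumes "A differentiable (at z)"
  shows "frechet_derivative A (at z) (hamiltonian_vector_field \<omega> H z) = pbracket \<omega> A H z"
  by (simp add: frechet_derivative_partial_deriv_sum[OF assms] hamiltonian_vector_field_component
      pbracket_def sum_distrib_left mult_ac)

text \<open>Linearity and the Leibniz rule: the bracket with \<open>A\<close> fixed is a derivation
  in its second argument.\<close>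

lemma pbracket_diff_sum_mult:
  assumes H: "H differentiable (at z)"
    and F: "\<And>\<beta>. F \<beta> differentiable (at z)" and G: "\<And>\<beta>. G \<beta> differentiable (at z)"
  shows "pbracket \<omega> A (\<lambda>y. H y - (\<Sum>\<beta>\<in>I. F \<beta> y * G \<beta> y)) z =
    pbracket \<omega> A H z - (\<Sum>\<beta>\<in>I. pbracket \<omega> A (F \<beta>) z * G \<beta> z + F \<beta> z * pbracket \<omega> A (G \<beta>) z)"
proof -
  note D = H[THEN frechet_derivative_works[THEN iffD1]] F[THEN frechet_derivative_works[THEN iffD1]]
    G[THEN frechet_derivative_works[THEN iffD1]]
  have "((\<lambda>y. H y - (\<Sum>\<beta>\<in>I. F \<beta> y * G \<beta> y)) has_derivative
      (\<lambda>h. frechet_derivative H (at z) h - (\<Sum>\<beta>\<in>I. F \<beta> z * frechet_derivative (G \<beta>) (at z) h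
        + frechet_derivative (F \<beta>) (at z) h * G \<beta> z))) (at z)"
    by (rule has_derivative_diff[OF D(1) has_derivative_sum[OF has_derivative_mult[OF D(2,3)]]])
  note fd = frechet_derivative_at[OF this, symmetric]
  have pd: "partial_deriv j (\<lambda>y. H y - (\<Sum>\<beta>\<in>I. F \<beta> y * G \<beta> y)) z = partial_deriv j H z
      - (\<Sum>\<beta>\<in>I. F \<beta> z * partial_deriv j (G \<beta>) z + partial_deriv j (F \<beta>) z * G \<beta> z)" for j
    by (simp add: partial_deriv_def fd)
  \<comment> \<open>Contracting the differential of \<open>A\<close> with \<omega> first makes the
    bracket a linear form in the partial derivatives of its second argument.\<close>
  define c where "c j = (\<Sum>i\<in>UNIV. partial_deriv i A z * \<omega> z $ i $ j)" for j
  have pb: "pbracket \<omega> A B z = (\<Sum>j\<in>UNIV. c j * partial_deriv j B z)" for B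
    unfolding pbracket_def c_def by (subst sum.swap) (simp add: sum_distrib_right)
  have "(\<Sum>j\<in>UNIV. c j * (\<Sum>\<beta>\<in>I. F \<beta> z * partial_deriv j (G \<beta>) z + partial_deriv j (F \<beta>) z * G \<beta> z))
     = (\<Sum>\<beta>\<in>I. \<Sum>j\<in>UNIV. c j * (F \<beta> z * partial_deriv j (G \<beta>) z + partial_deriv j (F \<beta>) z * G \<beta> z))"
    unfolding sum_distrib_left by (rule sum.swap)
  also have "\<dots> = (\<Sum>\<beta>\<in>I. pbracket \<omega> A (F \<beta>) z * G \<beta> z + F \<beta> z * pbracket \<omega> A (G \<beta>) z)"
    by (intro sum.cong refl)
      (simp add: pb sum_distrib_left sum_distrib_right sum.distrib[symmetric] algebra_simps)
  finally show ?thesis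
    by (simp add: pb[of "\<lambda>y. H y - _ y"] pb[of H] pd right_diff_distrib sum_subtractf)
qed

text \<open>The sum of squares of the unknowns vanishes at \<open>a\<close>, and its derivative is
  bounded by a multiple of itself, since 2|xy| is at most x^2 + y^2. The scalar inequality above
  then applies.\<close>

lemma vanishing_of_linear_system:
  fixes u :: "'p::finite \<Rightarrow> real \<Rightarrow> real"
  assumes T: "is_interval T" "a \<in> T" "t \<in> T"
    and du: "\<And>t \<alpha>. t \<in> T \<Longrightarrow> (u \<alpha> has_real_derivative (\<Sum>\<beta>\<in>UNIV. c \<alpha> \<beta> t * u \<beta> t)) (at t)"
    and C: "\<And>t \<alpha> \<beta>. t \<in> T \<Longrightarrow> \<bar>c \<alpha> \<beta> t\<bar> \<le> C"
    and "\<And>\<alpha>. u \<alpha> a = 0"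
  shows "u \<alpha> t = 0"
proof -
  define \<phi> where "\<phi> s = (\<Sum>\<alpha>\<in>UNIV. (u \<alpha> s)\<^sup>2)" for s
  define \<phi>' where "\<phi>' s = (\<Sum>\<alpha>\<in>UNIV. \<Sum>\<beta>\<in>UNIV. 2 * c \<alpha> \<beta> s * u \<alpha> s * u \<beta> s)" for s
  have "\<phi> t = 0"
  proof (rule linear_differential_inequality_zero[OF T])
    show "(\<phi> has_real_derivative \<phi>' s) (at s)" if "s \<in> T" for s
      unfolding \<phi>_def \<phi>'_def
      by (rule derivative_eq_intros refl du[OF that])+
        (simp add: sum_distrib_left sum_distrib_right mult_ac)
    show "\<bar>\<phi>' s\<bar> \<le> (2 * C * CARD('p)) * \<phi> s" if "s \<in> T" for s
    proof -
      have "\<bar>2 * c \<alpha> \<beta> s * u \<alpha> s * u \<beta> s\<bar> \<le> C * ((u \<alpha> s)\<^sup>2 + (u \<beta> s)\<^sup>2)" for \<alpha> \<beta>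
      proof -
        have "\<bar>2 * c \<alpha> \<beta> s * u \<alpha> s * u \<beta> s\<bar> = \<bar>c \<alpha> \<beta> s\<bar> * (2 * \<bar>u \<alpha> s\<bar> * \<bar>u \<beta> s\<bar>)"
          by (simp add: abs_mult)
        also have "\<dots> \<le> C * ((u \<alpha> s)\<^sup>2 + (u \<beta> s)\<^sup>2)"
          using sum_squares_bound[of "\<bar>u \<alpha> s\<bar>" "\<bar>u \<beta> s\<bar>"] C[OF that, of \<alpha> \<beta>]
          by (intro mult_mono) auto
        finally show ?thesis .
      qed
      then have "\<bar>\<phi>' s\<bar> \<le> (\<Sum>\<alpha>\<in>UNIV. \<Sum>\<beta>\<in>UNIV. C * ((u \<alpha> s)\<^sup>2 + (u \<beta> s)\<^sup>2))"
        unfolding \<phi>'_def by (intro order_trans[OF sum_abs] sum_mono)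
      \<comment> \<open>Each of the two squares, summed over both indices, contributes
        \<open>CARD('p)\<close> copies of \<phi>.\<close>
      also have "\<dots> = (2 * C * CARD('p)) * \<phi> s"
        by (simp add: \<phi>_def sum.distrib sum_distrib_left[symmetric] algebra_simps)
      finally show ?thesis .
    qed
  qed (simp_all add: \<phi>_def sum_nonneg assms(6))
  then show ?thesis
    unfolding \<phi>_def by (subst (asm) sum_nonneg_eq_0_iff) auto
qed

text \<open>Up to sign, the Lagrange multipliers that Dirac's theory assigns to second-class
  constraints. Separating them displays the correction to \<open>H\<close> as a sum of products,
  ready for the Leibniz rule.\<close>

definition dirac_multiplier ::
  "(real ^ 'n \<Rightarrow> real ^ 'n ^ 'n) \<Rightarrow> ('p::finite \<Rightarrow> real ^ 'n::finite \<Rightarrow> real)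
    \<Rightarrow> (real ^ 'n \<Rightarrow> real) \<Rightarrow> 'p \<Rightarrow> real ^ 'n \<Rightarrow> real"
where
  "dirac_multiplier \<omega> \<Phi> H \<alpha> z =
     (\<Sum>\<beta>\<in>UNIV. matrix_inv (constraint_matrix \<omega> \<Phi> z) $ \<alpha> $ \<beta> * pbracket \<omega> (\<Phi> \<beta>) H z)"

text \<open>A mere regrouping of the double sum, valid at every point; as an equality of functions
  it can be rewritten under derivatives.\<close>

lemma modified_hamiltonian_eq:
  "modified_hamiltonian \<omega> \<Phi> H = (\<lambda>z. H z - (\<Sum>\<alpha>\<in>UNIV. \<Phi> \<alpha> z * dirac_multiplier \<omega> \<Phi> H \<alpha> z))"
  by (simp add: fun_eq_iff modified_hamiltonian_def dirac_multiplier_def sum_distrib_left mult_ac)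

lemma constraint_matrix_dirac_multiplier:
  assumes "det (constraint_matrix \<omega> \<Phi> z) \<noteq> 0"
  shows "(\<Sum>\<beta>\<in>UNIV. pbracket \<omega> (\<Phi> \<alpha>) (\<Phi> \<beta>) z * dirac_multiplier \<omega> \<Phi> H \<beta> z)
    = pbracket \<omega> (\<Phi> \<alpha>) H z"
proof -
  define b where "b = (\<chi> \<beta>. pbracket \<omega> (\<Phi> \<beta>) H z)"
  have "(\<Sum>\<beta>\<in>UNIV. pbracket \<omega> (\<Phi> \<alpha>) (\<Phi> \<beta>) z * dirac_multiplier \<omega> \<Phi> H \<beta> z)
      = (constraint_matrix \<omega> \<Phi> z *v (matrix_inv (constraint_matrix \<omega> \<Phi> z) *v b)) $ \<alpha>"
    by (simp add: matrix_vector_mult_def dirac_multiplier_def b_def constraint_matrix_def)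
  also have "\<dots> = b $ \<alpha>"
    by (simp add: matrix_vector_mul_assoc matrix_inv_right[OF assms])
  finally show ?thesis by (simp add: b_def)
qed

text \<open>The identity holds off the constraint surface too, which matters because the integral
  curve is not known beforehand to remain on the surface.\<close>

lemma pbracket_modified_hamiltonian:
  assumes "det (constraint_matrix \<omega> \<Phi> z) \<noteq> 0" "H differentiable (at z)"
    "\<And>\<beta>. \<Phi> \<beta> differentiable (at z)" "\<And>\<beta>. dirac_multiplier \<omega> \<Phi> H \<beta> differentiable (at z)"
  shows "pbracket \<omega> (\<Phi> \<alpha>) (modified_hamiltonian \<omega> \<Phi> H) z
    = (\<Sum>\<beta>\<in>UNIV. - pbracket \<omega> (\<Phi> \<alpha>) (dirac_multiplier \<omega> \<Phi> H \<beta>) z * \<Phi> \<beta> z)"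
  unfolding modified_hamiltonian_eq
  by (simp add: pbracket_diff_sum_mult[of H z \<Phi>, OF assms(2-4)] sum.distrib sum_negf
      constraint_matrix_dirac_multiplier[OF assms(1)] mult.commute[of "\<Phi> _ z"])

section \<open>The flow of the modified Hamiltonian and its invariant constraint surface\<close>

theorem mainTheorem7:
  fixes U :: "(real ^ 'n::finite) set"
    and \<omega> :: "real ^ 'n \<Rightarrow> real ^ 'n ^ 'n"
    and H :: "real ^ 'n \<Rightarrow> real"
    and \<Phi> :: "'p::finite \<Rightarrow> real ^ 'n \<Rightarrow> real"
  assumes "open U"
    and "poisson_structure_on U \<omega>"
    and "smooth_on U H"
    and "\<And>\<alpha>. smooth_on U (\<Phi> \<alpha>)"
    and "functionally_independent_on U \<Phi>"
    and "\<And>z. z \<in> constraint_surface U \<Phi> \<Longrightarrow> det (constraint_matrix \<omega> \<Phi> z) \<noteq> 0"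
  shows "self_consistent U (hamiltonian_vector_field \<omega> (modified_hamiltonian \<omega> \<Phi> H)) \<Phi>"
  unfolding self_consistent_def
proof
  fix z\<^sub>0 assume z\<^sub>0: "z\<^sub>0 \<in> constraint_surface U \<Phi>"
  \<comment> \<open>An open neighbourhood of the constraint surface on which the inverse matrix, and
    with it the vector field, is smooth. The whole argument takes place inside it.\<close>
  define W where "W = {z \<in> U. det (constraint_matrix \<omega> \<Phi> z) \<noteq> 0}"
  define V where "V = hamiltonian_vector_field \<omega> (modified_hamiltonian \<omega> \<Phi> H)"
  define g where "g = dirac_multiplier \<omega> \<Phi> H"
  have "smooth_on U \<omega>"
    using assms(2) by (simp add: poisson_structure_on_def)
  have cm: "smooth_on U (\<lambda>z. constraint_matrix \<omega> \<Phi> z $ \<alpha> $ \<beta>)" for \<alpha> \<beta>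
    using smooth_on_pbracket[OF assms(1) \<open>smooth_on U \<omega>\<close> assms(4) assms(4)]
    by (simp add: constraint_matrix_def)
  have "open W"
    unfolding W_def
    using continuous_open_preimage[OF smooth_on_imp_continuous_on[OF smooth_on_det[OF assms(1) cm]]
        assms(1), of "- {0}"]
    by (simp add: open_Compl vimage_def Int_def)
  have "W \<subseteq> U" by (auto simp: W_def)
  note sub = smooth_on_subset[OF _ this]
  note smooth = sub[OF \<open>smooth_on U \<omega>\<close>] sub[OF assms(3)] sub[OF assms(4)]
  have g: "smooth_on W (g \<alpha>)" for \<alpha>
    unfolding g_def dirac_multiplier_def[abs_def]
    using \<open>open W\<close> smooth sub[OF cm]
    by (intro smooth_on_sum smooth_on_mult smooth_on_matrix_inv smooth_on_pbracket) (auto simp: W_def)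
  have V: "smooth_on W V"
    unfolding V_def modified_hamiltonian_eq g_def[symmetric]
    by (intro smooth_on_hamiltonian_vector_field smooth_on_diff smooth_on_sum smooth_on_mult
        \<open>open W\<close> smooth g)
  have "z\<^sub>0 \<in> W"
    using z\<^sub>0 assms(6) by (auto simp: W_def constraint_surface_def)
  then obtain r L where r: "0 < r" "cball z\<^sub>0 r \<subseteq> W"
    and L: "\<And>x y. x \<in> cball z\<^sub>0 r \<Longrightarrow> y \<in> cball z\<^sub>0 r \<Longrightarrow> norm (V x - V y) \<le> L * norm (x - y)"
    using smooth_on_locally_lipschitz[OF \<open>open W\<close> V] by metis
  obtain h z where "0 < h" and z: "z 0 = z\<^sub>0"
    and stay: "\<And>t. t \<in> {-h<..<h} \<Longrightarrow> z t \<in> cball z\<^sub>0 r"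
    and dz: "\<And>t. t \<in> {-h<..<h} \<Longrightarrow> (z has_vector_derivative V (z t)) (at t)"
    using picard_lindelof[of r z\<^sub>0 V L] r(1) L by metis
  define T where "T = {-h<..<h}"
  have T: "open T" "is_interval T" "0 \<in> T"
    using \<open>0 < h\<close> by (auto simp: T_def is_interval_1)
  have zW: "z t \<in> W" if "t \<in> T" for t
    using stay[of t] r(2) that by (auto simp: T_def)
  have diff: "f differentiable (at x)" if "smooth_on W f" "x \<in> W" for f :: "real ^ 'n \<Rightarrow> real" and x
    using smooth_on_has_derivative[OF that] unfolding differentiable_def by blast
  \<comment> \<open>The coefficients of the linear system for the constraints, evaluated along the
    curve.\<close>
  define c where "c \<alpha> \<beta> t = - pbracket \<omega> (\<Phi> \<alpha>) (g \<beta>) (z t)" for \<alpha> \<beta> t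
  have d\<Phi>: "((\<lambda>t. \<Phi> \<alpha> (z t)) has_real_derivative (\<Sum>\<beta>\<in>UNIV. c \<alpha> \<beta> t * \<Phi> \<beta> (z t))) (at t)"
    if "t \<in> T" for \<alpha> t
  proof -
    have D: "(\<Phi> \<alpha> has_derivative frechet_derivative (\<Phi> \<alpha>) (at (z t))) (at (z t))"
      using smooth_on_has_derivative[OF smooth(3) zW[OF that]] .
    have "((\<lambda>t. \<Phi> \<alpha> (z t)) has_derivative
        (\<lambda>h. frechet_derivative (\<Phi> \<alpha>) (at (z t)) (h *\<^sub>R V (z t)))) (at t)"
      using dz[of t] that
      by (intro has_derivative_compose[where f=z, OF _ D]) (simp add: has_vector_derivative_def T_def)
    then have "((\<lambda>t. \<Phi> \<alpha> (z t)) has_real_derivative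
        frechet_derivative (\<Phi> \<alpha>) (at (z t)) (V (z t))) (at t)"
      unfolding has_field_derivative_def linear_cmul[OF has_derivative_linear[OF D]]
      by (simp add: mult_commute_abs)
    moreover have "frechet_derivative (\<Phi> \<alpha>) (at (z t)) (V (z t)) = (\<Sum>\<beta>\<in>UNIV. c \<alpha> \<beta> t * \<Phi> \<beta> (z t))"
      unfolding V_def c_def g_def
      using zW[OF that] diff[OF smooth(2)] diff[OF smooth(3)] diff[OF g, unfolded g_def]
      by (simp add: frechet_derivative_hamiltonian_vector_field pbracket_modified_hamiltonian W_def)
    ultimately show ?thesis by simp
  qed
  \<comment> \<open>The curve stays in a compact ball inside \<open>W\<close>, where this continuous
    function is bounded. Summing over all pairs gives one bound for every coefficient.\<close>
  have "continuous_on W (\<lambda>x. \<Sum>\<alpha>\<in>UNIV. \<Sum>\<beta>\<in>UNIV. \<bar>pbracket \<omega> (\<Phi> \<alpha>) (g \<beta>) x\<bar>)"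
    by (intro continuous_intros smooth_on_imp_continuous_on smooth_on_pbracket \<open>open W\<close> smooth g)
  then have "bounded ((\<lambda>x. \<Sum>\<alpha>\<in>UNIV. \<Sum>\<beta>\<in>UNIV. \<bar>pbracket \<omega> (\<Phi> \<alpha>) (g \<beta>) x\<bar>) ` cball z\<^sub>0 r)"
    using r(2) by (intro compact_imp_bounded compact_continuous_image) (auto intro: continuous_on_subset)
  then obtain C where C: "x \<in> cball z\<^sub>0 r \<Longrightarrow> (\<Sum>\<alpha>\<in>UNIV. \<Sum>\<beta>\<in>UNIV. \<bar>pbracket \<omega> (\<Phi> \<alpha>) (g \<beta>) x\<bar>) \<le> C" for x
    unfolding bounded_iff real_norm_def using abs_le_D1 by blast
  have "\<bar>c \<alpha> \<beta> t\<bar> \<le> C" if "t \<in> T" for \<alpha> \<beta> t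
  proof -
    have "\<bar>c \<alpha> \<beta> t\<bar> \<le> (\<Sum>\<beta>\<in>UNIV. \<bar>pbracket \<omega> (\<Phi> \<alpha>) (g \<beta>) (z t)\<bar>)"
      using member_le_sum[of \<beta> UNIV "\<lambda>\<beta>. \<bar>pbracket \<omega> (\<Phi> \<alpha>) (g \<beta>) (z t)\<bar>"] by (simp add: c_def)
    also have "\<dots> \<le> (\<Sum>\<alpha>\<in>UNIV. \<Sum>\<beta>\<in>UNIV. \<bar>pbracket \<omega> (\<Phi> \<alpha>) (g \<beta>) (z t)\<bar>)"
      using member_le_sum[of \<alpha> UNIV "\<lambda>\<alpha>. \<Sum>\<beta>\<in>UNIV. \<bar>pbracket \<omega> (\<Phi> \<alpha>) (g \<beta>) (z t)\<bar>"]
      by (simp add: sum_nonneg)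
    also have "\<dots> \<le> C" using C stay that by (simp add: T_def)
    finally show ?thesis .
  qed
  \<comment> \<open>The initial values vanish because the curve starts at \<open>z\<^sub>0\<close>,
    a point of the surface.\<close>
  then have "\<Phi> \<alpha> (z t) = 0" if "t \<in> T" for \<alpha> t
    using vanishing_of_linear_system[OF T(2,3) that, of "\<lambda>\<alpha> t. \<Phi> \<alpha> (z t)" c C \<alpha>] d\<Phi> z z\<^sub>0
    by (simp add: constraint_surface_def)
  moreover have "smooth_on T z"
    using smooth_on_integral_curve[OF \<open>open W\<close> V T(1) zW] dz by (simp add: T_def)
  ultimately have "solution_on U V \<Phi> T z"
    using zW \<open>W \<subseteq> U\<close> dz by (auto simp: solution_on_def T_def)
  then show "\<exists>T \<tau>\<^sub>0 z. open T \<and> is_interval T \<and> \<tau>\<^sub>0 \<in> T \<and> z \<tau>\<^sub>0 = z\<^sub>0 \<and>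
      solution_on U (hamiltonian_vector_field \<omega> (modified_hamiltonian \<omega> \<Phi> H)) \<Phi> T z"
    using T z unfolding V_def by blast
qed

end
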